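(* Assume $n\ge2$. Let $W_L\in\mathcal{B}(\mathcal{F}_n^2\otimes\mathcal{E})$ be an odometer map with symbol $L\in\mathcal{B}(\mathcal{E},\mathcal{F}_n^2\otimes\mathcal{E})$. If $W_L$ is a hyponormal operator, then $$\|L\eta\|\ge\|\eta\|\quad\text{for all }\eta\in\mathcal{E}.$$ Consequently, if $\|L\|<1$ or if $L$ has a non-trivial kernel, then $W_L$ cannot be hyponormal and, consequently, cannot be subnormal.
   Context: $\mathcal{E}$ is a Hilbert space; Hilbert spaces are separable and complex; $\mathcal{B}(\mathcal{H},\mathcal{K})$ denotes the bounded linear operators from $\mathcal{H}$ to $\mathcal{K}$, and $\mathcal{B}(\mathcal{H})=\mathcal{B}(\mathcal{H},\mathcal{H})$. $F_n^+$ is the free monoid of words $\mu=\mu_1\cdots\mu_m$ in the letters $1,\dots,n$, with empty word $\emptyset$. The full Fock space $\mathcal{F}_n^2=\mathbb{C}\Omega\oplus\bigoplus_{k\ge1}(\mathbb{C}^n)^{\otimes k}$ has orthonormal basis $e_\mu=e_{\mu_1}\otimes\cdots\otimes e_{\mu_m}$, $\mu\in F_n^+$, with $e_\emptyset=\Omega$; $e_k^m:=e_k^{\otimes m}$, $e_k^0=\Omega$, and $\Omega$ acts as a unit for left tensoring. For $f\in\mathcal{F}_n^2\otimes\mathcal{E}$, $e_1^p\otimes f$ means left tensoring by $e_1^p$. Odometer map: for $L\in\mathcal{B}(\mathcal{E},\mathcal{F}_n^2\otimes\mathcal{E})$, $W_L$ is the bounded operator on $\mathcal{F}_n^2\otimes\mathcal{E}$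 given by $W_L(\Omega\otimes\eta)=L\eta$; $W_L(e_n^m\otimes\eta)=e_1^m\otimes L\eta$ for $m\ge1$; and, for a nonempty word $\mu=\mu_1\cdots\mu_m$ having some letter $\ne n$, with $k$ the smallest index such that $\mu_k\neq n$, $W_L(e_\mu\otimes\eta)=e_1^{k-1}\otimes e_{\mu_k+1}\otimes e_{\mu_{k+1}}\otimes\cdots\otimes e_{\mu_m}\otimes\eta$. A bounded operator $T$ on a Hilbert space $\mathcal{H}$ is hyponormal if $T^*T\ge TT^*$, i.e. $\|T^*x\|\le\|Tx\|$ for all $x\in\mathcal{H}$. $T$ is subnormal if there are a Hilbert space $\mathcal{K}\supseteq\mathcal{H}$ and a normal operator $N\in\mathcal{B}(\mathcal{K})$ leaving $\mathcal{H}$ invariant with $T=N|_{\mathcal{H}}$. *)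

theory Defs
  imports "HOL-Analysis.Analysis"
begin

section \<open>Separable complex Hilbert spaces\<close>

text \<open>
  A complex inner product space is a \<^class>\<open>real_inner\<close> space with a compatible complex scalar
  multiplication and a sesquilinear form, linear in its first argument, whose real part is the
  real inner product.  In particular the norm is the one induced by the complex inner product.
\<close>

class complex_inner = real_inner +
  fixes scaleC :: "complex \<Rightarrow> 'a \<Rightarrow> 'a"  (infixr "*\<^sub>C" 75)
    and cinner :: "'a \<Rightarrow> 'a \<Rightarrow> complex"
  assumes scaleC_add_right: "c *\<^sub>C (x + y) = c *\<^sub>C x + c *\<^sub>C y"
    and scaleC_add_left: "(c + d) *\<^sub>C x = c *\<^sub>C x + d *\<^sub>C x"
    and scaleC_scaleC: "c *\<^sub>C d *\<^sub>C x = (c * d) *\<^sub>C x"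
    and scaleC_of_real: "complex_of_real r *\<^sub>C x = r *\<^sub>R x"
    and cinner_commute: "cinner x y = cnj (cinner y x)"
    and cinner_add_left: "cinner (x + y) z = cinner x z + cinner y z"
    and cinner_scaleC_left: "cinner (c *\<^sub>C x) y = c * cinner x y"
    and Re_cinner: "Re (cinner x y) = inner x y"

text \<open>Hilbert spaces are separable throughout.\<close>

class complex_hilbert = complex_inner + complete_space +
  assumes separable: "\<exists>D. countable D \<and> (\<forall>x. \<forall>e>0. \<exists>d\<in>D. dist d x < e)"

lemma cinner_add_right: "cinner z (x + y) = cinner z x + cinner z y"
  for x y z :: "'a::complex_inner"
  by (metis cinner_add_left cinner_commute complex_cnj_add)

lemma cinner_scaleC_right: "cinner x (c *\<^sub>C y) = cnj c * cinner x y"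
  for x y :: "'a::complex_inner"
  by (metis cinner_scaleC_left cinner_commute complex_cnj_mult)

lemma scaleC_one [simp]: "1 *\<^sub>C x = x" for x :: "'a::complex_inner"
  using scaleC_of_real[of 1 x] by simp

lemma scaleC_zero [simp]: "0 *\<^sub>C x = 0" for x :: "'a::complex_inner"
  using scaleC_of_real[of 0 x] by simp

lemma scaleC_zero_right [simp]: "c *\<^sub>C 0 = 0" for c :: complex
proof -
  have "c *\<^sub>C (0::'a) = c *\<^sub>C (0 *\<^sub>C 0)" by simp
  also have "\<dots> = 0" unfolding scaleC_scaleC by simp
  finally show ?thesis .
qed

lemma cinner_zero_left [simp]: "cinner 0 x = 0" for x :: "'a::complex_inner"
  by (metis cinner_scaleC_left mult_zero_left scaleC_zero)

lemma cinner_zero_right [simp]: "cinner x 0 = 0" for x :: "'a::complex_inner"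
  by (metis cinner_commute cinner_zero_left complex_cnj_zero)

lemma cinner_minus_left: "cinner (- x) y = - cinner x y" for x y :: "'a::complex_inner"
  using cinner_add_left[of x "-x" y] by (simp add: minus_unique)

lemma cinner_diff_left: "cinner (x - y) z = cinner x z - cinner y z"
  for x y z :: "'a::complex_inner"
  using cinner_add_left[of x "-y" z] by (simp add: cinner_minus_left)

lemma cinner_diff_right: "cinner z (x - y) = cinner z x - cinner z y"
  for x y z :: "'a::complex_inner"
  by (metis cinner_commute cinner_diff_left complex_cnj_diff)

lemma cinner_self: "cinner x x = complex_of_real ((norm x)\<^sup>2)" for x :: "'a::complex_inner"
proof (rule complex_eqI)
  show "Re (cinner x x) = Re (complex_of_real ((norm x)\<^sup>2))"
    by (simp add: Re_cinner power2_norm_eq_inner del: of_real_power)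
  have "Im (cinner x x) = - Im (cinner x x)"
    by (metis cinner_commute cnj.simps(2))
  then show "Im (cinner x x) = Im (complex_of_real ((norm x)\<^sup>2))"
    by (simp del: of_real_power)
qed

lemma norm_scaleC: "norm (c *\<^sub>C x) = cmod c * norm x" for x :: "'a::complex_inner"
proof -
  have "complex_of_real ((norm (c *\<^sub>C x))\<^sup>2) = c * cnj c * complex_of_real ((norm x)\<^sup>2)"
    by (simp only: cinner_self[symmetric] cinner_scaleC_left cinner_scaleC_right mult_ac)
  also have "\<dots> = complex_of_real ((cmod c * norm x)\<^sup>2)"
    by (simp add: complex_norm_square[symmetric] power_mult_distrib)
  finally have "(norm (c *\<^sub>C x))\<^sup>2 = (cmod c * norm x)\<^sup>2"
    by (simp only: of_real_eq_iff)
  then show ?thesis by (simp add: power2_eq_iff_nonneg)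
qed

lemma complex_Cauchy_Schwarz: "cmod (cinner x y) \<le> norm x * norm y"
  for x y :: "'a::complex_inner"
proof (cases "cinner x y = 0")
  case False
  define c where "c = cnj (cinner x y) / cmod (cinner x y)"
  have "c * cinner x y = complex_of_real (cmod (cinner x y))"
    using False unfolding c_def
    by (simp add: field_simps complex_norm_square[symmetric] power2_eq_square[symmetric])
  then have "cmod (cinner x y) = inner (c *\<^sub>C x) y"
    by (metis Re_cinner Re_complex_of_real cinner_scaleC_left)
  also have "\<dots> \<le> norm (c *\<^sub>C x) * norm y" by (rule norm_cauchy_schwarz)
  also have "cmod c = 1" using False by (simp add: c_def norm_divide)
  then have "norm (c *\<^sub>C x) = norm x" by (simp add: norm_scaleC)
  finally show ?thesis .
qed auto

instantiation complex :: complex_hilbert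
begin

definition scaleC_complex :: "complex \<Rightarrow> complex \<Rightarrow> complex" where
  "scaleC_complex c z = c * z"

definition cinner_complex :: "complex \<Rightarrow> complex \<Rightarrow> complex" where
  "cinner_complex z w = z * cnj w"

instance
proof
  obtain D :: "complex set" where D: "countable D" "\<And>X. open X \<Longrightarrow> X \<noteq> {} \<Longrightarrow> \<exists>d\<in>D. d \<in> X"
    using countable_dense_setE by blast
  have "\<exists>d\<in>D. dist d x < e" if "e > 0" for x e
    using D(2)[of "ball x e"] that by (auto simp: dist_commute)
  with D(1) show "\<exists>D::complex set. countable D \<and> (\<forall>x. \<forall>e>0. \<exists>d\<in>D. dist d x < e)"
    by blast
qed (auto simp: scaleC_complex_def cinner_complex_def scaleR_conv_of_real inner_complex_def algebra_simps)

end


section \<open>Bounded operators, adjoints, hyponormal and subnormal operators\<close>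

definition bounded_clinear :: "('a::complex_inner \<Rightarrow> 'b::complex_inner) \<Rightarrow> bool" where
  "bounded_clinear T \<longleftrightarrow> bounded_linear T \<and> (\<forall>c x. T (c *\<^sub>C x) = c *\<^sub>C T x)"

definition cadjoint :: "('a::complex_hilbert \<Rightarrow> 'b::complex_hilbert) \<Rightarrow> 'b \<Rightarrow> 'a" where
  "cadjoint T = (THE S. \<forall>x y. cinner (T x) y = cinner x (S y))"

definition op_le :: "('a::complex_hilbert \<Rightarrow> 'a) \<Rightarrow> ('a \<Rightarrow> 'a) \<Rightarrow> bool" where
  "op_le A B \<longleftrightarrow> (\<forall>x. cinner (B x - A x) x \<in> \<real> \<and> 0 \<le> Re (cinner (B x - A x) x))"

definition hyponormal :: "('a::complex_hilbert \<Rightarrow> 'a) \<Rightarrow> bool" where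
  "hyponormal T \<longleftrightarrow> bounded_clinear T \<and> op_le (T \<circ> cadjoint T) (cadjoint T \<circ> T)"

definition normal_operator :: "('a::complex_hilbert \<Rightarrow> 'a) \<Rightarrow> bool" where
  "normal_operator N \<longleftrightarrow> bounded_clinear N \<and> cadjoint N \<circ> N = N \<circ> cadjoint N"

text \<open>
  \<open>subnormal TYPE('k) T\<close>: there is a normal extension of \<open>T\<close> on the Hilbert space \<open>'k\<close>.  The
  inclusion of Hilbert spaces is rendered by a linear isometry \<open>V\<close>; the equation says that \<open>N\<close>
  leaves the range of \<open>V\<close> invariant and restricts to \<open>T\<close> there.  HOL cannot quantify over the
  type \<open>'k\<close> inside a formula, so subnormality of \<open>T\<close> is the existence of a type \<open>'k\<close> with
  \<open>subnormal TYPE('k) T\<close>, and a theorem \<open>\<not> subnormal TYPE('k) T\<close> with \<open>'k\<close> a type variable says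
  that \<open>T\<close> is not subnormal.
\<close>

definition subnormal :: "'k::complex_hilbert itself \<Rightarrow> ('a::complex_hilbert \<Rightarrow> 'a) \<Rightarrow> bool" where
  "subnormal _ T \<longleftrightarrow> bounded_clinear T \<and>
     (\<exists>(V :: 'a \<Rightarrow> 'k) N. bounded_clinear V \<and> (\<forall>x. norm (V x) = norm x) \<and>
        normal_operator N \<and> (\<forall>x. N (V x) = V (T x)))"

lemma Riesz_real:
  fixes \<phi> :: "'a::{real_inner,complete_space} \<Rightarrow> real"
  assumes "bounded_linear \<phi>"
  shows "\<exists>z. \<forall>x. \<phi> x = inner x z"
proof -
  interpret bounded_linear \<phi> by fact
  define J where "J x = (norm x)\<^sup>2 - 2 * \<phi> x" for x
  obtain K where K: "\<And>x. norm (\<phi> x) \<le> norm x * K" using bounded by blast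
  have lower: "- K\<^sup>2 \<le> J x" for x
  proof -
    have "2 * \<phi> x \<le> 2 * (norm x * K)" using K[of x] by simp
    also have "\<dots> \<le> (norm x)\<^sup>2 + K\<^sup>2" using sum_squares_bound[of "norm x" K] by simp
    finally show ?thesis by (simp add: J_def)
  qed
  define m where "m = Inf (range J)"
  have bdd: "bdd_below (range J)" using lower by (auto intro!: bdd_belowI)
  have m: "m \<le> J x" for x unfolding m_def by (rule cInf_lower[OF _ bdd]) simp
  have "\<exists>x. J x < m + 1 / Suc k" for k
    using cInf_lessD[of "range J" "m + 1 / Suc k"] by (auto simp: m_def)
  then obtain X where X: "\<And>k. J (X k) < m + 1 / Suc k" by metis
  have par: "(norm (x - y))\<^sup>2 = 2 * J x + 2 * J y - 4 * J ((1/2) *\<^sub>R (x + y))" for x y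
    unfolding J_def power2_norm_eq_inner
    by (simp add: scaleR add algebra_simps inner_commute)
  have bound: "(norm (X k - X l))\<^sup>2 < 2 / Suc k + 2 / Suc l" for k l
  proof -
    have "4 * m \<le> 4 * J ((1/2) *\<^sub>R (X k + X l))" "2 * J (X k) < 2 * (m + 1 / Suc k)"
      "2 * J (X l) < 2 * (m + 1 / Suc l)"
      by (intro mult_left_mono mult_strict_left_mono m X; simp)+
    then have "2 * J (X k) + 2 * J (X l) - 4 * J ((1/2) *\<^sub>R (X k + X l)) < 2 * (1 / Suc k) + 2 * (1 / Suc l)"
      unfolding distrib_left by linarith
    then show ?thesis using par[of "X k" "X l"] by simp
  qed
  have "Cauchy X"
  proof (rule metric_CauchyI)
    fix e :: real assume e: "e > 0"
    obtain M where "4 / e\<^sup>2 < real M"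
      using reals_Archimedean2 by blast
    then have M: "4 / e\<^sup>2 < real (Suc M)" by simp
    have "dist (X k) (X l) < e" if "M \<le> k" "M \<le> l" for k l
    proof -
      have "2 / real (Suc k) \<le> 2 / Suc M" "2 / real (Suc l) \<le> 2 / Suc M"
        using that by (auto intro!: divide_left_mono)
      then have "(norm (X k - X l))\<^sup>2 < 4 / Suc M" using bound[of k l] by linarith
      also have "\<dots> < e\<^sup>2" using M e by (simp add: field_simps)
      finally show ?thesis using e by (simp add: dist_norm power_less_imp_less_base)
    qed
    then show "\<exists>M. \<forall>k\<ge>M. \<forall>l\<ge>M. dist (X k) (X l) < e" by blast
  qed
  then obtain z where z: "X \<longlonglongrightarrow> z" by (meson Cauchy_convergent_iff convergent_def)
  have "(\<lambda>k. J (X k)) \<longlonglongrightarrow> J z" unfolding J_def by (intro tendsto_intros z tendsto)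
  moreover have "(\<lambda>k. m + 1 / Suc k) \<longlonglongrightarrow> m + 0"
    by (intro tendsto_intros LIMSEQ_inverse_real_of_nat[simplified inverse_eq_divide])
  ultimately have "J z \<le> m + 0" by (rule LIMSEQ_le) (use X less_imp_le in blast)
  then have Jz: "J z \<le> J x" for x using m[of x] by simp
  have "\<phi> v = inner v z" for v
  proof -
    define d where "d = inner v z - \<phi> v"
    have quad: "0 \<le> t\<^sup>2 * (norm v)\<^sup>2 + 2 * t * d" for t
      using Jz[of "z + t *\<^sub>R v"] unfolding J_def d_def power2_norm_eq_inner
      by (simp add: add scaleR algebra_simps inner_commute power2_eq_square)
    have "d = 0"
    proof (rule ccontr)
      assume d: "d \<noteq> 0"
      define s where "s = (norm v)\<^sup>2 + 1"
      have s: "s > 0" "(norm v)\<^sup>2 < s" by (auto simp: s_def add_nonneg_pos)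
      have "0 \<le> (-d/s)\<^sup>2 * (norm v)\<^sup>2 + 2 * (-d/s) * d" by (rule quad)
      also have "(-d/s)\<^sup>2 * (norm v)\<^sup>2 \<le> (-d/s)\<^sup>2 * s" using s by (intro mult_left_mono) auto
      also have "(-d/s)\<^sup>2 * s + 2 * (-d/s) * d = - (d\<^sup>2 / s)"
        using s by (simp add: field_simps power2_eq_square)
      also have "\<dots> < 0" using d s by simp
      finally show False by simp
    qed
    then show ?thesis by (simp add: d_def)
  qed
  then show ?thesis by blast
qed

text \<open>Every bounded operator has a unique adjoint, so the definite description is meaningful.\<close>

lemma cadjoint:
  fixes T :: "'a::complex_hilbert \<Rightarrow> 'b::complex_hilbert"
  assumes T: "bounded_clinear T"
  shows "cinner (T x) y = cinner x (cadjoint T y)"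
proof -
  have lin: "bounded_linear T" and sc: "T (c *\<^sub>C x) = c *\<^sub>C T x" for c x
    using T by (auto simp: bounded_clinear_def)
  have "\<exists>z. \<forall>x. cinner (T x) y = cinner x z" for y
  proof -
    have "bounded_linear (\<lambda>x. inner (T x) y)"
      by (rule bounded_linear_compose[OF bounded_linear_inner_left lin])
    then obtain z where z: "\<And>x. inner (T x) y = inner x z" using Riesz_real by blast
    have re: "Re (cinner (T x) y) = Re (cinner x z)" for x by (simp add: Re_cinner z)
    have "Im (cinner (T x) y) = Im (cinner x z)" for x
      using re[of "\<i> *\<^sub>C x"] by (simp add: sc cinner_scaleC_left)
    with re have "cinner (T x) y = cinner x z" for x by (simp add: complex_eq_iff)
    then show ?thesis by blast
  qed
  then obtain S where S: "\<forall>x y. cinner (T x) y = cinner x (S y)" by metis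
  have "R = S" if R: "\<forall>x y. cinner (T x) y = cinner x (R y)" for R
  proof
    fix y
    have "cinner (R y - S y) (R y - S y) = 0"
      using R S by (simp add: cinner_diff_right)
    then show "R y = S y" by (simp add: cinner_self)
  qed
  with S have "cadjoint T = S" unfolding cadjoint_def by (intro the_equality) auto
  with S show ?thesis by simp
qed

lemma hyponormal_iff:
  fixes T :: "'a::complex_hilbert \<Rightarrow> 'a"
  shows "hyponormal T \<longleftrightarrow> bounded_clinear T \<and> (\<forall>x. norm (cadjoint T x) \<le> norm (T x))"
proof (cases "bounded_clinear T")
  case True
  have "cinner (cadjoint T (T x) - T (cadjoint T x)) x
        = complex_of_real ((norm (T x))\<^sup>2 - (norm (cadjoint T x))\<^sup>2)" for x
  proof -
    have "cinner (cadjoint T (T x)) x = cinner (T x) (T x)"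
      by (metis cadjoint[OF True] cinner_commute)
    moreover have "cinner (T (cadjoint T x)) x = cinner (cadjoint T x) (cadjoint T x)"
      by (rule cadjoint[OF True])
    ultimately show ?thesis by (simp add: cinner_diff_left cinner_self)
  qed
  then show ?thesis
    using True by (simp add: hyponormal_def op_le_def power2_le_iff_abs_le)
qed (simp add: hyponormal_def)


section \<open>Square-summable families\<close>

typedef (overloaded) ('i, 'e) ell2 =
  "{f :: 'i \<Rightarrow> 'e::complex_inner. (\<lambda>i. (norm (f i))\<^sup>2) summable_on UNIV}"
  morphisms coeff Abs_ell2
  by (rule exI[of _ "\<lambda>_. 0"]) simp

setup_lifting type_definition_ell2

lemma ell2_eqI: "(\<And>i. coeff f i = coeff g i) \<Longrightarrow> f = g"
  by (metis coeff_inject ext)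

lemma coeff_summable: "(\<lambda>i. (norm (coeff f i))\<^sup>2) summable_on A"
  by (rule summable_on_subset_banach[of _ UNIV]) (use coeff[of f] in auto)

lemma norm_add_square_le: "(norm (x + y))\<^sup>2 \<le> 2 * (norm x)\<^sup>2 + 2 * (norm y)\<^sup>2"
  for x y :: "'a::real_inner"
proof -
  have "0 \<le> (norm (x - y))\<^sup>2" by simp
  then show ?thesis
    unfolding power2_norm_eq_inner by (simp add: algebra_simps inner_commute)
qed

instantiation ell2 :: (type, complex_inner) complex_inner
begin

lift_definition zero_ell2 :: "('a, 'b) ell2" is "\<lambda>_. 0" by simp

lift_definition plus_ell2 :: "('a, 'b) ell2 \<Rightarrow> ('a, 'b) ell2 \<Rightarrow> ('a, 'b) ell2"
  is "\<lambda>f g i. f i + g i"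
proof -
  fix f g :: "'a \<Rightarrow> 'b"
  assume "(\<lambda>i. (norm (f i))\<^sup>2) summable_on UNIV" "(\<lambda>i. (norm (g i))\<^sup>2) summable_on UNIV"
  then have "(\<lambda>i. 2 * (norm (f i))\<^sup>2 + 2 * (norm (g i))\<^sup>2) summable_on UNIV"
    by (intro summable_on_add summable_on_cmult_right)
  then show "(\<lambda>i. (norm (f i + g i))\<^sup>2) summable_on UNIV"
    by (rule summable_on_comparison_test) (auto intro: norm_add_square_le)
qed

lift_definition uminus_ell2 :: "('a, 'b) ell2 \<Rightarrow> ('a, 'b) ell2" is "\<lambda>f i. - f i" by simp

definition minus_ell2 :: "('a, 'b) ell2 \<Rightarrow> ('a, 'b) ell2 \<Rightarrow> ('a, 'b) ell2" where
  "minus_ell2 f g = f + (- g)"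

lift_definition scaleR_ell2 :: "real \<Rightarrow> ('a, 'b) ell2 \<Rightarrow> ('a, 'b) ell2" is "\<lambda>r f i. r *\<^sub>R f i"
  by (simp add: power_mult_distrib summable_on_cmult_right)

lift_definition scaleC_ell2 :: "complex \<Rightarrow> ('a, 'b) ell2 \<Rightarrow> ('a, 'b) ell2" is "\<lambda>c f i. c *\<^sub>C f i"
  by (simp add: norm_scaleC power_mult_distrib summable_on_cmult_right)

definition inner_ell2 :: "('a, 'b) ell2 \<Rightarrow> ('a, 'b) ell2 \<Rightarrow> real" where
  "inner_ell2 f g = (\<Sum>\<^sub>\<infinity>i. inner (coeff f i) (coeff g i))"

definition cinner_ell2 :: "('a, 'b) ell2 \<Rightarrow> ('a, 'b) ell2 \<Rightarrow> complex" where
  "cinner_ell2 f g = (\<Sum>\<^sub>\<infinity>i. cinner (coeff f i) (coeff g i))"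

definition norm_ell2 :: "('a, 'b) ell2 \<Rightarrow> real" where
  "norm_ell2 f = sqrt (inner f f)"

definition sgn_ell2 :: "('a, 'b) ell2 \<Rightarrow> ('a, 'b) ell2" where
  "sgn_ell2 f = inverse (norm f) *\<^sub>R f"

definition dist_ell2 :: "('a, 'b) ell2 \<Rightarrow> ('a, 'b) ell2 \<Rightarrow> real" where
  "dist_ell2 f g = norm (f - g)"

definition uniformity_ell2 :: "(('a, 'b) ell2 \<times> ('a, 'b) ell2) filter" where
  "uniformity_ell2 = (INF e\<in>{0<..}. principal {(f, g). dist f g < e})"

definition open_ell2 :: "('a, 'b) ell2 set \<Rightarrow> bool" where
  "open_ell2 U \<longleftrightarrow> (\<forall>f\<in>U. \<forall>\<^sub>F (f', g) in uniformity. f' = f \<longrightarrow> g \<in> U)"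

lemma cinner_coeff_summable: "(\<lambda>i. cinner (coeff f i) (coeff g i)) summable_on A"
  for f g :: "('a, 'b) ell2"
proof -
  have "(\<lambda>i. (norm (coeff f i))\<^sup>2 + (norm (coeff g i))\<^sup>2) summable_on A"
    by (intro summable_on_add coeff_summable)
  then have "(\<lambda>i. norm (cinner (coeff f i) (coeff g i))) summable_on A"
  proof (rule summable_on_comparison_test)
    fix i
    have "norm (cinner (coeff f i) (coeff g i)) \<le> norm (coeff f i) * norm (coeff g i)"
      by (rule complex_Cauchy_Schwarz)
    also have "\<dots> \<le> (norm (coeff f i))\<^sup>2 + (norm (coeff g i))\<^sup>2"
      using sum_squares_bound[of "norm (coeff f i)" "norm (coeff g i)"]
        mult_nonneg_nonneg[OF norm_ge_zero norm_ge_zero, of "coeff f i" "coeff g i"]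
      unfolding mult.assoc by linarith
    finally show "norm (cinner (coeff f i) (coeff g i)) \<le> (norm (coeff f i))\<^sup>2 + (norm (coeff g i))\<^sup>2" .
  qed auto
  then show ?thesis by (rule abs_summable_summable)
qed

lemma inner_coeff_summable: "(\<lambda>i. inner (coeff f i) (coeff g i)) summable_on A"
  for f g :: "('a, 'b) ell2"
  using summable_on_Re[OF cinner_coeff_summable[of f g A]] by (simp add: Re_cinner)

instance
proof
  fix f g h :: "('a, 'b) ell2" and c d :: complex and r s :: real
  show "f + g + h = f + (g + h)" by transfer (simp add: algebra_simps)
  show "f + g = g + f" by transfer (simp add: algebra_simps)
  show "0 + f = f" by transfer simp
  show "- f + f = 0" by transfer simp
  show "f - g = f + - g" by (rule minus_ell2_def)
  show "r *\<^sub>R (f + g) = r *\<^sub>R f + r *\<^sub>R g" by transfer (simp add: algebra_simps)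
  show "(r + s) *\<^sub>R f = r *\<^sub>R f + s *\<^sub>R f" by transfer (simp add: algebra_simps)
  show "r *\<^sub>R s *\<^sub>R f = (r * s) *\<^sub>R f" by transfer simp
  show "1 *\<^sub>R f = f" by transfer simp
  show "c *\<^sub>C (f + g) = c *\<^sub>C f + c *\<^sub>C g" by transfer (simp add: scaleC_add_right)
  show "(c + d) *\<^sub>C f = c *\<^sub>C f + d *\<^sub>C f" by transfer (simp add: scaleC_add_left)
  show "c *\<^sub>C d *\<^sub>C f = (c * d) *\<^sub>C f" by transfer (simp add: scaleC_scaleC)
  show "complex_of_real r *\<^sub>C f = r *\<^sub>R f" by transfer (simp add: scaleC_of_real)
  show "dist f g = norm (f - g)" by (rule dist_ell2_def)
  show "sgn f = inverse (norm f) *\<^sub>R f" by (rule sgn_ell2_def)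
  show "uniformity = (INF e\<in>{0<..}. principal {(f, g :: ('a, 'b) ell2). dist f g < e})"
    by (rule uniformity_ell2_def)
  show "open U \<longleftrightarrow> (\<forall>f\<in>U. \<forall>\<^sub>F (f', g) in uniformity. f' = f \<longrightarrow> g \<in> U)"
    for U :: "('a, 'b) ell2 set"
    by (rule open_ell2_def)
  show "norm f = sqrt (inner f f)" by (rule norm_ell2_def)
  show "inner f g = inner g f" by (simp add: inner_ell2_def inner_commute)
  show "inner (f + g) h = inner f h + inner g h"
    unfolding inner_ell2_def
    by (simp add: plus_ell2.rep_eq inner_add_left infsum_add[OF inner_coeff_summable inner_coeff_summable])
  show "inner (r *\<^sub>R f) g = r * inner f g"
    unfolding inner_ell2_def
    by (simp add: scaleR_ell2.rep_eq infsum_cmult_right[OF inner_coeff_summable])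
  show "0 \<le> inner f f" unfolding inner_ell2_def by (rule infsum_nonneg) simp
  show "inner f f = 0 \<longleftrightarrow> f = 0"
  proof
    assume "inner f f = 0"
    then have "inner (coeff f i) (coeff f i) = 0" for i
      unfolding inner_ell2_def
      using nonneg_infsum_le_0D[OF _ inner_coeff_summable[of f f UNIV], of i] by simp
    then show "f = 0" by (intro ell2_eqI) (simp add: zero_ell2.rep_eq)
  qed (simp add: inner_ell2_def zero_ell2.rep_eq)
  show "cinner f g = cnj (cinner g f)"
    unfolding cinner_ell2_def infsum_cnj[symmetric] by (intro infsum_cong) (rule cinner_commute)
  show "cinner (f + g) h = cinner f h + cinner g h"
    unfolding cinner_ell2_def
    by (simp add: plus_ell2.rep_eq cinner_add_left infsum_add[OF cinner_coeff_summable cinner_coeff_summable])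
  show "cinner (c *\<^sub>C f) g = c * cinner f g"
    unfolding cinner_ell2_def
    by (simp add: scaleC_ell2.rep_eq cinner_scaleC_left infsum_cmult_right[OF cinner_coeff_summable])
  show "Re (cinner f g) = inner f g"
    unfolding cinner_ell2_def inner_ell2_def
    by (simp add: infsum_Re[OF cinner_coeff_summable, symmetric] Re_cinner)
qed

end

lemma norm_ell2_square: "(norm f)\<^sup>2 = (\<Sum>\<^sub>\<infinity>i. (norm (coeff f i))\<^sup>2)" for f :: "('i, 'e::complex_inner) ell2"
  by (simp add: power2_norm_eq_inner inner_ell2_def)

lemma sum_coeff_le: "finite F \<Longrightarrow> (\<Sum>i\<in>F. (norm (coeff f i))\<^sup>2) \<le> (norm f)\<^sup>2"
  unfolding norm_ell2_square by (rule finite_sum_le_infsum) (auto intro: coeff_summable)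

lemma norm_coeff_le: "norm (coeff f i) \<le> norm f"
  using sum_coeff_le[of "{i}" f] by (simp add: power2_le_iff_abs_le)

lemma coeff_diff: "coeff (f - g) i = coeff f i - coeff g i"
  unfolding minus_ell2_def plus_ell2.rep_eq uminus_ell2.rep_eq by simp

lemma coeff_sum: "coeff (\<Sum>x\<in>A. f x) i = (\<Sum>x\<in>A. coeff (f x) i)"
  by (induction A rule: infinite_finite_induct) (auto simp: zero_ell2.rep_eq plus_ell2.rep_eq)

instance ell2 :: (type, "{complex_inner, complete_space}") complete_space
proof
  fix X :: "nat \<Rightarrow> ('a, 'b) ell2"
  assume X: "Cauchy X"
  have "Cauchy (\<lambda>m. coeff (X m) i)" for i
  proof (rule metric_CauchyI)
    fix e :: real assume "e > 0"
    then obtain M where "\<forall>k\<ge>M. \<forall>l\<ge>M. dist (X k) (X l) < e" using X metric_CauchyD by blast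
    then show "\<exists>M. \<forall>k\<ge>M. \<forall>l\<ge>M. dist (coeff (X k) i) (coeff (X l) i) < e"
      by (metis coeff_diff dist_norm norm_coeff_le order_le_less_trans)
  qed
  then have "\<exists>g. (\<lambda>m. coeff (X m) i) \<longlonglongrightarrow> g" for i
    by (meson Cauchy_convergent_iff convergent_def)
  then obtain g where g: "\<And>i. (\<lambda>m. coeff (X m) i) \<longlonglongrightarrow> g i" by metis
  have fin: "\<exists>M. \<forall>k\<ge>M. \<forall>F. finite F \<longrightarrow> (\<Sum>i\<in>F. (norm (coeff (X k) i - g i))\<^sup>2) \<le> e\<^sup>2"
    if e: "e > 0" for e :: real
  proof -
    obtain M where M: "\<And>k l. k \<ge> M \<Longrightarrow> l \<ge> M \<Longrightarrow> dist (X k) (X l) < e"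
      using X e metric_CauchyD by blast
    have "(\<Sum>i\<in>F. (norm (coeff (X k) i - g i))\<^sup>2) \<le> e\<^sup>2" if k: "k \<ge> M" and F: "finite F" for k F
    proof (rule LIMSEQ_le_const2)
      show "(\<lambda>l. \<Sum>i\<in>F. (norm (coeff (X k) i - coeff (X l) i))\<^sup>2)
              \<longlonglongrightarrow> (\<Sum>i\<in>F. (norm (coeff (X k) i - g i))\<^sup>2)"
        by (intro tendsto_intros g)
      have "(\<Sum>i\<in>F. (norm (coeff (X k) i - coeff (X l) i))\<^sup>2) \<le> e\<^sup>2" if "l \<ge> M" for l
      proof -
        have "(\<Sum>i\<in>F. (norm (coeff (X k) i - coeff (X l) i))\<^sup>2) \<le> (norm (X k - X l))\<^sup>2"
          using sum_coeff_le[OF F, of "X k - X l"] by (simp add: coeff_diff)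
        also have "\<dots> \<le> e\<^sup>2" using M[OF k that] by (intro power_mono) (auto simp: dist_norm)
        finally show ?thesis .
      qed
      then show "\<exists>N. \<forall>l\<ge>N. (\<Sum>i\<in>F. (norm (coeff (X k) i - coeff (X l) i))\<^sup>2) \<le> e\<^sup>2" by blast
    qed
    then show ?thesis by blast
  qed
  have summ: "(\<lambda>i. (norm (coeff (X k) i - g i))\<^sup>2) summable_on UNIV"
    if "\<forall>F. finite F \<longrightarrow> (\<Sum>i\<in>F. (norm (coeff (X k) i - g i))\<^sup>2) \<le> B" for k B
    by (rule nonneg_bdd_above_summable_on) (use that in \<open>auto intro!: bdd_aboveI\<close>)
  obtain M where M: "\<And>F. finite F \<Longrightarrow> (\<Sum>i\<in>F. (norm (coeff (X M) i - g i))\<^sup>2) \<le> 1"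
    using fin[of 1] by auto
  define h where "h = X M - Abs_ell2 (\<lambda>i. coeff (X M) i - g i)"
  have h: "coeff h = g"
    unfolding h_def using summ[of M 1] M by (auto simp: coeff_diff Abs_ell2_inverse)
  have "X \<longlonglongrightarrow> h"
  proof (rule metric_LIMSEQ_I)
    fix e :: real assume e: "e > 0"
    obtain N where N: "\<And>k F. k \<ge> N \<Longrightarrow> finite F \<Longrightarrow>
        (\<Sum>i\<in>F. (norm (coeff (X k) i - g i))\<^sup>2) \<le> (e/2)\<^sup>2"
      using fin[of "e/2"] e by auto
    have "dist (X k) h < e" if k: "k \<ge> N" for k
    proof -
      have "(norm (X k - h))\<^sup>2 = (\<Sum>\<^sub>\<infinity>i. (norm (coeff (X k) i - g i))\<^sup>2)"
        by (simp add: norm_ell2_square coeff_diff h)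
      also have "\<dots> \<le> (e/2)\<^sup>2"
        by (rule infsum_le_finite_sums) (use N[OF k] summ[of k "(e/2)\<^sup>2"] in auto)
      finally have "norm (X k - h) \<le> e/2" using e by (simp add: power2_le_iff_abs_le)
      then show ?thesis using e by (simp add: dist_norm)
    qed
    then show "\<exists>N. \<forall>k\<ge>N. dist (X k) h < e" by blast
  qed
  then show "convergent X" by (auto simp: convergent_def)
qed

lift_definition single :: "'i \<Rightarrow> 'e::complex_inner \<Rightarrow> ('i, 'e) ell2" is "\<lambda>i x j. if j = i then x else 0"
proof -
  fix i :: 'i and x :: 'e
  have "(\<lambda>j. (norm (if j = i then x else 0))\<^sup>2) summable_on UNIV \<longleftrightarrow>
        (\<lambda>j. (norm (if j = i then x else 0))\<^sup>2) summable_on {i}"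
    by (rule summable_on_cong_neutral) auto
  then show "(\<lambda>j. (norm (if j = i then x else 0))\<^sup>2) summable_on UNIV" by simp
qed

lemma norm_single [simp]: "norm (single i x) = norm x"
proof -
  have "(norm (single i x))\<^sup>2 = (\<Sum>\<^sub>\<infinity>j\<in>{i}. (norm (coeff (single i x) j))\<^sup>2)"
    unfolding norm_ell2_square by (rule infsum_cong_neutral) (auto simp: single.rep_eq)
  then have "(norm (single i x))\<^sup>2 = (norm x)\<^sup>2" by (simp add: single.rep_eq)
  then show ?thesis by (simp add: power2_eq_iff_nonneg)
qed

lemma single_diff: "single i x - single i y = single i (x - y)"
  by (rule ell2_eqI) (simp add: coeff_diff single.rep_eq)

lemma ell2_approx:
  fixes f :: "('i, 'e::complex_inner) ell2"
  assumes e: "e > 0"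
  shows "\<exists>F. finite F \<and> dist (\<Sum>i\<in>F. single i (coeff f i)) f < e"
proof -
  have "e\<^sup>2 / 2 > 0" using e by simp
  from infsum_finite_approximation[OF coeff_summable this, of UNIV f]
  obtain F where F: "finite F"
    "dist (\<Sum>i\<in>F. (norm (coeff f i))\<^sup>2) (\<Sum>\<^sub>\<infinity>i. (norm (coeff f i))\<^sup>2) \<le> e\<^sup>2 / 2"
    by blast
  define g where "g = (\<Sum>i\<in>F. single i (coeff f i)) - f"
  have g: "coeff g i = (if i \<in> F then 0 else - coeff f i)" for i
    using F(1) by (simp add: g_def coeff_diff coeff_sum single.rep_eq)
  have "(norm g)\<^sup>2 = (\<Sum>\<^sub>\<infinity>i\<in>-F. (norm (coeff f i))\<^sup>2)"
    unfolding norm_ell2_square by (rule infsum_cong_neutral) (auto simp: g)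
  also have "\<dots> = (\<Sum>\<^sub>\<infinity>i. (norm (coeff f i))\<^sup>2) - (\<Sum>i\<in>F. (norm (coeff f i))\<^sup>2)"
    using infsum_Un_disjoint[OF coeff_summable[of f F] coeff_summable[of f "-F"]] F(1) by simp
  also have "\<dots> \<le> e\<^sup>2 / 2" using F(2) unfolding dist_real_def by linarith
  also have "\<dots> < e\<^sup>2" using e by simp
  finally have "norm g < e" using e by (simp add: power_less_imp_less_base)
  then show ?thesis using F(1) by (auto simp: g_def dist_norm)
qed

instance ell2 :: (countable, complex_hilbert) complex_hilbert
proof
  obtain A :: "'b set" where A: "countable A" "\<And>x e. e > 0 \<Longrightarrow> \<exists>d\<in>A. dist d x < e"
    using separable[where ?'a = 'b] by blast
  define D :: "('a, 'b) ell2 set" where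
    "D = (\<lambda>l. \<Sum>p\<leftarrow>l. single (fst p) (snd p)) ` lists (UNIV \<times> A)"
  have "countable D"
    unfolding D_def using A(1) by (intro countable_image countable_lists countable_SIGMA) auto
  moreover have "\<exists>d\<in>D. dist d f < e" if e: "e > 0" for f e
  proof -
    obtain F where F: "finite F" "dist (\<Sum>i\<in>F. single i (coeff f i)) f < e / 2"
      using ell2_approx[of "e/2" f] e by auto
    define \<delta> where "\<delta> = e / (2 * (card F + 1))"
    have "\<delta> > 0" using e by (simp add: \<delta>_def)
    then have "\<exists>a. a \<in> A \<and> dist a (coeff f i) < \<delta>" for i
      using A(2)[of \<delta> "coeff f i"] by blast
    then obtain a where a: "\<And>i. a i \<in> A" "\<And>i. dist (a i) (coeff f i) < \<delta>"
      by metis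
    define d where "d = (\<Sum>i\<in>F. single i (a i))"
    obtain l where l: "set l = F" "distinct l" using F(1) finite_distinct_list by blast
    have "d = (\<Sum>p\<leftarrow>map (\<lambda>i. (i, a i)) l. single (fst p) (snd p))"
      unfolding d_def using l by (simp add: sum_list_distinct_conv_sum_set comp_def)
    moreover have "map (\<lambda>i. (i, a i)) l \<in> lists (UNIV \<times> A)" using a(1) by auto
    ultimately have "d \<in> D" unfolding D_def by (rule image_eqI)
    moreover have "dist d (\<Sum>i\<in>F. single i (coeff f i)) \<le> e / 2"
    proof -
      have "dist d (\<Sum>i\<in>F. single i (coeff f i)) = norm (\<Sum>i\<in>F. single i (a i - coeff f i))"
        by (simp add: d_def dist_norm sum_subtractf[symmetric] single_diff)
      also have "\<dots> \<le> (\<Sum>i\<in>F. norm (single i (a i - coeff f i)))" by (rule norm_sum)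
      also have "\<dots> \<le> (\<Sum>i\<in>F. \<delta>)"
        using a(2) by (intro sum_mono) (simp add: dist_norm less_imp_le)
      also have "\<dots> \<le> e / 2" using e by (simp add: \<delta>_def field_simps)
      finally show ?thesis .
    qed
    ultimately show ?thesis
      using F(2) dist_triangle[of d f "\<Sum>i\<in>F. single i (coeff f i)"] by force
  qed
  ultimately show "\<exists>D::('a, 'b) ell2 set. countable D \<and> (\<forall>f. \<forall>e>0. \<exists>d\<in>D. dist d f < e)"
    by blast
qed


section \<open>The full Fock space and odometer maps\<close>

text \<open>
  The alphabet \<open>{1..n}\<close> with \<open>n = CARD('n)\<close>, as a type; the free monoid on \<open>n\<close> generators is the
  type of lists of letters.
\<close>

typedef (overloaded) 'n letter = "{1..CARD('n::finite)}"
  morphisms letter_number letter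
  by (rule exI[of _ 1]) (simp add: Suc_leI)

instance letter :: (finite) finite
proof
  have "range (letter_number :: 'a letter \<Rightarrow> nat) \<subseteq> {1..CARD('a)}"
    by (rule image_subsetI) (rule letter_number)
  then have "finite (range (letter_number :: 'a letter \<Rightarrow> nat))"
    by (rule finite_subset) (rule finite_atLeastAtMost)
  then show "finite (UNIV :: 'a letter set)"
    by (rule finite_imageD) (simp add: inj_on_def letter_number_inject)
qed

definition first_letter :: "'n::finite letter" where "first_letter = letter 1"

definition last_letter :: "'n::finite letter" where "last_letter = letter CARD('n)"

text \<open>Only meaningful for letters other than the last one.\<close>

definition next_letter :: "'n::finite letter \<Rightarrow> 'n letter" where
  "next_letter a = letter (letter_number a + 1)"

text \<open>
  The full Fock space is the orthogonal sum of \<open>(\<complex>\<^sup>n)\<^sup>\<otimes>\<^sup>k\<close> over \<open>k \<ge> 0\<close>, in coordinates with respect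
  to the product bases; its elements are the square-summable families of coordinates indexed by
  words.  The Hilbert space tensor product of \<open>\<ell>\<^sup>2(I)\<close> and \<open>\<E>\<close> is the space of square-summable
  \<open>\<E>\<close>-valued families on \<open>I\<close>, see \<open>cinner_tensor\<close> and \<open>tensor_total\<close> below.
\<close>

type_synonym 'n fock = "('n letter list, complex) ell2"
type_synonym ('n, 'e) fock_tensor = "('n letter list, 'e) ell2"

definition fock_basis :: "'n::finite letter list \<Rightarrow> 'n fock" where
  "fock_basis \<mu> = single \<mu> 1"

lift_definition tensor :: "('i, complex) ell2 \<Rightarrow> 'e::complex_inner \<Rightarrow> ('i, 'e) ell2"  (infixr "\<otimes>\<^sub>C" 70)
  is "\<lambda>x \<eta> i. x i *\<^sub>C \<eta>"
  by (simp add: norm_scaleC power_mult_distrib summable_on_cmult_left)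

text \<open>
  Left tensoring \<open>f \<mapsto> e\<^sub>\<mu> \<otimes> f\<close> by the basis vector of the word \<open>\<mu>\<close>: the coordinate of \<open>f\<close> at \<open>\<nu>\<close>
  becomes the coordinate at \<open>\<mu> @ \<nu>\<close>; see \<open>left_tensor_tensor_basis\<close>.
\<close>

lift_definition left_tensor ::
  "'n::finite letter list \<Rightarrow> ('n, 'e::complex_inner) fock_tensor \<Rightarrow> ('n, 'e) fock_tensor"
  is "\<lambda>\<mu> f \<nu>. if take (length \<mu>) \<nu> = \<mu> then f (drop (length \<mu>) \<nu>) else 0"
proof -
  fix \<mu> :: "'n letter list" and f :: "'n letter list \<Rightarrow> 'e"
  let ?g = "\<lambda>\<nu>. if take (length \<mu>) \<nu> = \<mu> then f (drop (length \<mu>) \<nu>) else 0"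
  assume f: "(\<lambda>\<nu>. (norm (f \<nu>))\<^sup>2) summable_on UNIV"
  have inj: "inj ((@) \<mu>)" by (simp add: inj_on_def)
  have "(\<lambda>\<nu>. (norm (?g \<nu>))\<^sup>2) summable_on range ((@) \<mu>)"
    using f by (simp add: summable_on_reindex[OF inj] comp_def)
  also have "?this \<longleftrightarrow> (\<lambda>\<nu>. (norm (?g \<nu>))\<^sup>2) summable_on UNIV"
    by (rule summable_on_cong_neutral) (auto, metis append_take_drop_id rangeI)
  finally show "(\<lambda>\<nu>. (norm (?g \<nu>))\<^sup>2) summable_on UNIV" .
qed

lemma tensor_single: "single i c \<otimes>\<^sub>C \<eta> = single i (c *\<^sub>C \<eta>)"
  by (rule ell2_eqI) (simp add: tensor.rep_eq single.rep_eq)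

lemma cinner_tensor: "cinner (x \<otimes>\<^sub>C \<eta>) (y \<otimes>\<^sub>C \<zeta>) = cinner x y * cinner \<eta> \<zeta>"
proof -
  have "cinner (x \<otimes>\<^sub>C \<eta>) (y \<otimes>\<^sub>C \<zeta>) = (\<Sum>\<^sub>\<infinity>i. cinner (coeff x i) (coeff y i) * cinner \<eta> \<zeta>)"
    by (simp add: cinner_ell2_def tensor.rep_eq cinner_scaleC_left cinner_scaleC_right
        cinner_complex_def mult_ac)
  also have "\<dots> = cinner x y * cinner \<eta> \<zeta>"
    by (simp add: cinner_ell2_def infsum_cmult_left[OF cinner_coeff_summable])
  finally show ?thesis .
qed

lemma tensor_total: "closure (span (range (\<lambda>(x, \<eta>). x \<otimes>\<^sub>C \<eta>))) = (UNIV :: ('i, 'e::complex_inner) ell2 set)"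
proof -
  have "f \<in> closure (span (range (\<lambda>(x, \<eta>). x \<otimes>\<^sub>C \<eta>)))" for f :: "('i, 'e) ell2"
    unfolding closure_approachable
  proof (intro allI impI)
    fix e :: real assume "e > 0"
    then obtain F where F: "dist (\<Sum>i\<in>F. single i (coeff f i)) f < e" using ell2_approx by blast
    have "single i (coeff f i) = (\<lambda>(x, \<eta>). x \<otimes>\<^sub>C \<eta>) (single i 1, coeff f i)" for i
      by (simp add: tensor_single)
    then have "(\<Sum>i\<in>F. single i (coeff f i)) \<in> span (range (\<lambda>(x, \<eta>). x \<otimes>\<^sub>C \<eta>))"
      by (intro span_sum span_base) blast
    with F show "\<exists>y\<in>span (range (\<lambda>(x, \<eta>). x \<otimes>\<^sub>C \<eta>)). dist y f < e" by blast
  qed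
  then show ?thesis by blast
qed

lemma cinner_fock_basis: "cinner (fock_basis \<mu>) (fock_basis \<nu>) = (if \<mu> = \<nu> then 1 else 0)"
proof -
  have "cinner (fock_basis \<mu>) (fock_basis \<nu>)
        = (\<Sum>\<^sub>\<infinity>i\<in>{\<mu>}. cinner (coeff (fock_basis \<mu>) i) (coeff (fock_basis \<nu>) i))"
    unfolding cinner_ell2_def
    by (rule infsum_cong_neutral) (auto simp: fock_basis_def single.rep_eq)
  then show ?thesis by (simp add: fock_basis_def single.rep_eq cinner_complex_def)
qed

lemma left_tensor_tensor_basis:
  "left_tensor \<mu> (fock_basis \<nu> \<otimes>\<^sub>C \<eta>) = fock_basis (\<mu> @ \<nu>) \<otimes>\<^sub>C \<eta>"
proof (rule ell2_eqI)
  fix \<kappa>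
  have "\<kappa> = \<mu> @ \<nu> \<longleftrightarrow> take (length \<mu>) \<kappa> = \<mu> \<and> drop (length \<mu>) \<kappa> = \<nu>"
    by (metis append_eq_conv_conj)
  then show "coeff (left_tensor \<mu> (fock_basis \<nu> \<otimes>\<^sub>C \<eta>)) \<kappa> = coeff (fock_basis (\<mu> @ \<nu>) \<otimes>\<^sub>C \<eta>) \<kappa>"
    by (simp add: left_tensor.rep_eq tensor.rep_eq fock_basis_def single.rep_eq)
qed

text \<open>
  \<open>odometer_map L W\<close>: \<open>L\<close> is a bounded operator and \<open>W\<close> is the odometer map with symbol \<open>L\<close>.  The
  formulas determine a bounded \<open>W\<close> uniquely, but not every \<open>L\<close> admits one, so this is a
  predicate.  A nonempty word having some letter other than the last one is uniquely
  \<open>replicate j last_letter @ a # \<nu>\<close> with \<open>a \<noteq> last_letter\<close>, where \<open>j = k - 1\<close> for the least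
  one-based position \<open>k\<close> of such a letter.
\<close>

definition odometer_map ::
  "('e::complex_hilbert \<Rightarrow> ('n::finite, 'e) fock_tensor) \<Rightarrow>
   (('n, 'e) fock_tensor \<Rightarrow> ('n, 'e) fock_tensor) \<Rightarrow> bool" where
  "odometer_map L W \<longleftrightarrow> bounded_clinear L \<and> bounded_clinear W \<and>
     (\<forall>\<eta>. W (fock_basis [] \<otimes>\<^sub>C \<eta>) = L \<eta>) \<and>
     (\<forall>m\<ge>1. \<forall>\<eta>. W (fock_basis (replicate m last_letter) \<otimes>\<^sub>C \<eta>)
                  = left_tensor (replicate m first_letter) (L \<eta>)) \<and>
     (\<forall>j a \<nu> \<eta>. a \<noteq> last_letter \<longrightarrow>
        W (fock_basis (replicate j last_letter @ a # \<nu>) \<otimes>\<^sub>C \<eta>)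
          = fock_basis (replicate j first_letter @ next_letter a # \<nu>) \<otimes>\<^sub>C \<eta>)"

end

theory Submission
  imports Defs
begin

text \<open>
  The vector \<open>x = e\<^sub>n \<otimes> \<eta>\<close> lies both in the part where \<open>W\<close> acts through \<open>L\<close>, so that
  \<open>\<parallel>W x\<parallel> = \<parallel>L \<eta>\<parallel>\<close>, and, as \<open>n \<ge> 2\<close>, in the image of the part where \<open>W\<close> permutes basis
  vectors: \<open>x = W y\<close> with \<open>y = e\<^bsub>n-1\<^esub> \<otimes> \<eta>\<close>.  The latter gives \<open>\<parallel>W\<^sup>* x\<parallel> \<ge> \<parallel>\<eta>\<parallel>\<close>, and hyponormality
  compares the two.
\<close>

text \<open>Polarization recovers the real part of the inner product from norms alone; replacing
  \<open>x\<close> by \<open>\<i> *\<^sub>C x\<close> turns the imaginary part into a real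
  part.\<close>

lemma isometry_cinner:
  fixes V :: "'a::complex_inner \<Rightarrow> 'b::complex_inner"
  assumes V: "bounded_clinear V" and iso: "\<And>x. norm (V x) = norm x"
  shows "cinner (V x) (V y) = cinner x y"
proof -
  interpret bounded_linear V using V by (simp add: bounded_clinear_def)
  have sc: "V (c *\<^sub>C x) = c *\<^sub>C V x" for c x using V by (simp add: bounded_clinear_def)
  have re: "Re (cinner (V x) (V y)) = Re (cinner x y)" for x y
    by (simp add: Re_cinner dot_norm iso flip: add)
  have "Im (cinner (V x) (V y)) = Im (cinner x y)"
    using re[of "\<i> *\<^sub>C x" y] by (simp add: sc cinner_scaleC_left)
  with re show ?thesis by (simp add: complex_eq_iff)
qed

text \<open>Both squared norms are quadratic forms at \<open>x\<close>, one of \<open>N\<close>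
  after its adjoint and one of the adjoint after \<open>N\<close>; normality identifies the two
  operators.\<close>

lemma normal_imp_norm_cadjoint:
  assumes "normal_operator N"
  shows "norm (cadjoint N x) = norm (N x)"
proof -
  have N: "bounded_clinear N" and comm: "cadjoint N (N x) = N (cadjoint N x)"
    using assms by (auto simp: normal_operator_def fun_eq_iff)
  have "cinner (cadjoint N x) (cadjoint N x) = cinner (N (cadjoint N x)) x"
    by (simp add: cadjoint[OF N])
  also have "\<dots> = cnj (cinner x (cadjoint N (N x)))"
    unfolding comm by (rule cinner_commute)
  also have "\<dots> = cinner (N x) (N x)"
    unfolding cadjoint[OF N, symmetric] by (rule cinner_commute[symmetric])
  finally have "(norm (cadjoint N x))\<^sup>2 = (norm (N x))\<^sup>2"
    by (simp only: cinner_self of_real_eq_iff)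
  then show ?thesis by (simp add: power2_eq_iff_nonneg)
qed

text \<open>The square of the norm of \<open>cadjoint T x\<close> is carried by \<open>V\<close>
  into the larger space, where \<open>N\<close> moves across as its adjoint. Cauchy-Schwarz and
  normality then bound it without any projection onto the range of \<open>V\<close>.\<close>

lemma subnormal_imp_hyponormal:
  fixes T :: "'a::complex_hilbert \<Rightarrow> 'a"
  assumes "subnormal TYPE('k::complex_hilbert) T"
  shows "hyponormal T"
proof -
  obtain V :: "'a \<Rightarrow> 'k" and N where T: "bounded_clinear T" and V: "bounded_clinear V"
    and iso: "\<And>x. norm (V x) = norm x" and N: "normal_operator N"
    and NV: "\<And>x. N (V x) = V (T x)"
    using assms by (auto simp: subnormal_def)
  have N': "bounded_clinear N" using N by (simp add: normal_operator_def)
  have "norm (cadjoint T x) \<le> norm (T x)" for x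
  proof -
    have "cinner (cadjoint T x) (cadjoint T x) = cinner (V (T (cadjoint T x))) (V x)"
      by (simp add: cadjoint[OF T] isometry_cinner[OF V iso])
    also have "\<dots> = cinner (V (cadjoint T x)) (cadjoint N (V x))"
      by (simp add: cadjoint[OF N'] flip: NV)
    finally have "(norm (cadjoint T x))\<^sup>2 = cmod (cinner (V (cadjoint T x)) (cadjoint N (V x)))"
      by (metis cinner_self norm_of_real abs_of_nonneg zero_le_power2)
    also have "\<dots> \<le> norm (cadjoint T x) * norm (T x)"
      using complex_Cauchy_Schwarz[of "V (cadjoint T x)" "cadjoint N (V x)"]
      by (simp add: normal_imp_norm_cadjoint[OF N] NV iso)
    finally have "norm (cadjoint T x) * norm (cadjoint T x) \<le> norm (cadjoint T x) * norm (T x)"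
      by (simp add: power2_eq_square)
    \<comment> \<open>The common factor cancels unless it vanishes, and then the claim is
      trivial.\<close>
    then show ?thesis
      by (cases "cadjoint T x = 0") auto
  qed
  then show ?thesis using T by (simp add: hyponormal_iff)
qed

text \<open>Pairing \<open>cadjoint T (T y)\<close> with \<open>y\<close> gives the square of
  \<open>norm (T y)\<close>; Cauchy-Schwarz then allows division by \<open>norm y\<close>.\<close>

lemma norm_le_norm_cadjoint_image:
  assumes T: "bounded_clinear T" and "norm (T y) = norm y"
  shows "norm (T y) \<le> norm (cadjoint T (T y))"
proof (cases "y = 0")
  case False
  have "(norm (T y))\<^sup>2 = cmod (cinner y (cadjoint T (T y)))"
    by (metis cadjoint[OF T] cinner_self norm_of_real abs_of_nonneg zero_le_power2)
  also have "\<dots> \<le> norm y * norm (cadjoint T (T y))" by (rule complex_Cauchy_Schwarz)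
  finally show ?thesis using False assms(2) by (simp add: power2_eq_square)
qed (use assms(2) in simp)

text \<open>Prefixing \<open>\<mu>\<close> is injective on words, so the coefficients are only
  relocated, with zeros elsewhere.\<close>

lemma norm_left_tensor: "norm (left_tensor \<mu> f) = norm f"
proof -
  have inj: "inj ((@) \<mu>)" by (simp add: inj_on_def)
  have outside: "coeff (left_tensor \<mu> f) \<nu> = 0" if "\<nu> \<notin> range ((@) \<mu>)" for \<nu>
  proof -
    have "take (length \<mu>) \<nu> \<noteq> \<mu>"
      using that by (metis append_take_drop_id rangeI)
    then show ?thesis by (simp add: left_tensor.rep_eq)
  qed
  have "(norm (left_tensor \<mu> f))\<^sup>2 = (\<Sum>\<^sub>\<infinity>\<nu>\<in>range ((@) \<mu>). (norm (coeff (left_tensor \<mu> f) \<nu>))\<^sup>2)"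
    unfolding norm_ell2_square
    by (rule infsum_cong_neutral) (simp_all add: outside)
  also have "\<dots> = (norm f)\<^sup>2"
    unfolding norm_ell2_square infsum_reindex[OF inj]
    by (simp add: comp_def left_tensor.rep_eq)
  finally show ?thesis by (simp add: power2_eq_iff_nonneg)
qed

lemma norm_fock_basis_tensor: "norm (fock_basis \<mu> \<otimes>\<^sub>C \<eta>) = norm \<eta>"
  by (simp add: fock_basis_def tensor_single)

lemma hyponormal_odometer_norm_ge:
  fixes L :: "'e::complex_hilbert \<Rightarrow> ('n::finite, 'e) fock_tensor"
  assumes n: "CARD('n) \<ge> 2" and W: "odometer_map L W" and hyp: "hyponormal W"
  shows "norm \<eta> \<le> norm (L \<eta>)"
proof -
  \<comment> \<open>This is the letter n-1, which lies in the alphabet because n is at least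
    2.\<close>
  define a :: "'n letter" where "a = letter (CARD('n) - 1)"
  have a: "letter_number a = CARD('n) - 1"
    using n by (simp add: a_def letter_inverse)
  have "letter_number (last_letter :: 'n letter) = CARD('n)"
    using n by (simp add: last_letter_def letter_inverse)
  with a n have ne: "a \<noteq> last_letter" by auto
  have next_a: "next_letter a = last_letter"
    using n by (simp add: next_letter_def last_letter_def a)
  define x y where "x = fock_basis [last_letter :: 'n letter] \<otimes>\<^sub>C \<eta>" and "y = fock_basis [a] \<otimes>\<^sub>C \<eta>"
  have bounded: "bounded_clinear W"
    and power_last: "\<And>m. m \<ge> 1 \<Longrightarrow> W (fock_basis (replicate m last_letter) \<otimes>\<^sub>C \<eta>)
          = left_tensor (replicate m first_letter) (L \<eta>)"
    and carry: "\<And>j \<nu>. W (fock_basis (replicate j last_letter @ a # \<nu>) \<otimes>\<^sub>C \<eta>)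
          = fock_basis (replicate j first_letter @ next_letter a # \<nu>) \<otimes>\<^sub>C \<eta>"
    using W ne by (simp_all add: odometer_map_def)
  \<comment> \<open>The one-letter word has no leading last letters and an empty tail, so
    \<open>W\<close> merely advances its letter.\<close>
  have Wy: "W y = x" using carry[of 0 "[]"] by (simp add: x_def y_def next_a)
  have "norm \<eta> = norm (W y)" by (simp add: Wy x_def norm_fock_basis_tensor)
  also have "\<dots> \<le> norm (cadjoint W (W y))"
    by (rule norm_le_norm_cadjoint_image[OF bounded])
      (simp add: Wy, simp add: x_def y_def norm_fock_basis_tensor)
  also have "\<dots> \<le> norm (W x)" using hyp by (simp add: hyponormal_iff Wy)
  also have "W x = left_tensor [first_letter] (L \<eta>)" using power_last[of 1] by (simp add: x_def)
  finally show ?thesis by (simp add: norm_left_tensor)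
qed

text \<open>The condition that some vector is nonzero excludes the zero space, on which
  \<open>onorm L\<close> is 0 and yet every operator is hyponormal.\<close>

theorem theorem7p9:
  fixes L :: "'e::complex_hilbert \<Rightarrow> ('n::finite, 'e) fock_tensor"
    and W :: "('n, 'e) fock_tensor \<Rightarrow> ('n, 'e) fock_tensor"
  assumes n: "CARD('n) \<ge> 2"
    and W: "odometer_map L W"
  shows "(hyponormal W \<longrightarrow> (\<forall>\<eta>. norm (L \<eta>) \<ge> norm \<eta>)) \<and>
    (((\<exists>\<eta>::'e. \<eta> \<noteq> 0) \<and> onorm L < 1) \<or> {\<eta>. L \<eta> = 0} \<noteq> {0} \<longrightarrow>
       \<not> hyponormal W \<and> \<not> subnormal TYPE('k::complex_hilbert) W)"
proof -
  interpret L: bounded_linear L using W by (simp add: odometer_map_def bounded_clinear_def)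
  have ge: "norm \<eta> \<le> norm (L \<eta>)" if "hyponormal W" for \<eta>
    by (rule hyponormal_odometer_norm_ge[OF n W that])
  have less: "\<exists>\<eta>. norm (L \<eta>) < norm \<eta>"
    if "((\<exists>\<eta>::'e. \<eta> \<noteq> 0) \<and> onorm L < 1) \<or> {\<eta>. L \<eta> = 0} \<noteq> {0}"
    using that
  proof
    assume "(\<exists>\<eta>::'e. \<eta> \<noteq> 0) \<and> onorm L < 1"
    then obtain \<eta> :: 'e where "\<eta> \<noteq> 0" "onorm L < 1" by blast
    then have "onorm L * norm \<eta> < norm \<eta>" by simp
    with onorm[OF L.bounded_linear_axioms, of \<eta>] show ?thesis by (meson le_less_trans)
  next
    assume "{\<eta>. L \<eta> = 0} \<noteq> {0}"
    then obtain \<eta> where "L \<eta> = 0" "\<eta> \<noteq> 0" using L.zero by blast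
    then show ?thesis by (intro exI[of _ \<eta>]) simp
  qed
  have not_hyp: "\<not> hyponormal W"
    if "((\<exists>\<eta>::'e. \<eta> \<noteq> 0) \<and> onorm L < 1) \<or> {\<eta>. L \<eta> = 0} \<noteq> {0}"
    using less[OF that] ge by (meson not_le)
  show ?thesis
  proof (intro conjI impI allI)
    show "\<not> subnormal TYPE('k) W"
      if "((\<exists>\<eta>::'e. \<eta> \<noteq> 0) \<and> onorm L < 1) \<or> {\<eta>. L \<eta> = 0} \<noteq> {0}"
      using not_hyp[OF that] subnormal_imp_hyponormal[where T = W and 'k = 'k] by (rule contrapos_nn)
  qed (use ge not_hyp in simp_all)
qed

end
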